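(* For every $x\in\mathbb{C}$ with $x\neq 0$, $$J_0(x)=\frac{1}{\pi x}\int_0^{\pi}\sin(\phi)\,\frac{\partial}{\partial x}\bigl(x\sin(x\sin\phi)\bigr)\,d\phi .$$
   Context: $J_0(x)=\sum_{m=0}^{\infty}\frac{(-1)^m}{(m!)^2}\left(\frac{x}{2}\right)^{2m}$ is the Bessel function of the first kind of order $0$. Explicitly, $\frac{\partial}{\partial x}\bigl(x\sin(x\sin\phi)\bigr)=\sin(x\sin\phi)+x\sin\phi\cos(x\sin\phi)$. *)

theory Defs
  imports "HOL-Analysis.Analysis"
begin

definition bessel_J0 :: "complex \<Rightarrow> complex" where
  "bessel_J0 x = (\<Sum>m. (- 1) ^ m / (fact m)\<^sup>2 * (x / 2) ^ (2 * m))"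

lemma summable_bessel_J0:
  "summable (\<lambda>m. (- 1) ^ m / (fact m)\<^sup>2 * (x / 2) ^ (2 * m) :: complex)"
proof (rule summable_comparison_test')
  show "summable (\<lambda>m. inverse (fact m) * (norm ((x / 2)\<^sup>2)) ^ m)"
    by (rule summable_exp)
next
  fix m :: nat
  let ?y = "norm ((x / 2)\<^sup>2)"
  have "(1::real) \<le> fact m" by (rule fact_ge_1)
  then have "(fact m :: real) \<le> fact m ^ 2"
    by (rule self_le_power) simp
  then have "inverse (fact m ^ 2) \<le> inverse (fact m :: real)"
    by (rule le_imp_inverse_le) (rule fact_gt_zero)
  then have "inverse (fact m ^ 2) * ?y ^ m \<le> inverse (fact m :: real) * ?y ^ m"
    by (rule mult_right_mono) (rule zero_le_power, rule norm_ge_zero)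
  moreover have "norm ((- 1) ^ m / (fact m)\<^sup>2 * (x / 2) ^ (2 * m) :: complex)
      = inverse (fact m ^ 2) * ?y ^ m"
    unfolding power_mult norm_mult norm_divide norm_power norm_fact
      norm_minus_cancel norm_one power_one inverse_eq_divide ..
  ultimately show "norm ((- 1) ^ m / (fact m)\<^sup>2 * (x / 2) ^ (2 * m) :: complex)
      \<le> inverse (fact m) * ?y ^ m"
    by (rule ord_eq_le_trans[rotated])
qed

lemma deriv_mult_sin_mult:
  fixes x s :: complex
  shows "deriv (\<lambda>z. z * sin (z * s)) x = sin (x * s) + x * s * cos (x * s)"
  by (rule DERIV_imp_deriv) (auto intro!: derivative_eq_intros)

end

theory Submission
  imports Defs
begin

text \<open>Expand the integrand in powers of \<open>x sin \<phi>\<close>. The series converges uniformly in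
  \<open>\<phi>\<close>, so it may be integrated termwise, and Wallis' integrals of even powers of the sine
  turn it into \<open>\<pi> x\<close> times the Bessel series.\<close>

text \<open>Wallis' recurrence by induction: \<open>?F\<close> vanishes at both endpoints, so
  integrating its derivative \<open>?f\<close> links the integrals of two consecutive even powers by
  the ratio (2k+1)/(2k+2).\<close>

lemma has_integral_sin_even_power:
  "((\<lambda>t. sin t ^ (2 * k)) has_integral (pi * fact (2 * k) / (4 ^ k * (fact k)\<^sup>2))) {0..pi}"
proof (induction k)
  case 0
  show ?case using has_integral_const_real[of "1::real" 0 pi] by simp
next
  case (Suc k)
  let ?F = "\<lambda>t::real. - cos t * sin t ^ Suc (2 * k)"
  let ?f = "\<lambda>t::real. (2 * real k + 2) * sin t ^ (2 * Suc k) - (2 * real k + 1) * sin t ^ (2 * k)"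
  have "(?F has_real_derivative ?f t) (at t within {0..pi})" for t
  proof -
    have "(?F has_real_derivative
        sin t * sin t ^ Suc (2 * k) - cos t * ((2 * real k + 1) * sin t ^ (2 * k) * cos t))
        (at t within {0..pi})"
      by (auto intro!: derivative_eq_intros simp del: power_Suc)
    also have "cos t * ((2 * real k + 1) * sin t ^ (2 * k) * cos t)
        = (2 * real k + 1) * sin t ^ (2 * k) * (cos t)\<^sup>2"
      by (simp add: power2_eq_square)
    also have "sin t * sin t ^ Suc (2 * k) - (2 * real k + 1) * sin t ^ (2 * k) * (cos t)\<^sup>2 = ?f t"
      unfolding cos_squared_eq by (simp add: algebra_simps power2_eq_square)
    finally show ?thesis .
  qed
  then have "(?f has_integral (?F pi - ?F 0)) {0..pi}"
    by (intro fundamental_theorem_of_calculus)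
      (auto simp: has_real_derivative_iff_has_vector_derivative[symmetric])
  \<comment> \<open>Adding 2k+1 times the induction hypothesis cancels the lower power in
    \<open>?f\<close>.\<close>
  from has_integral_add[OF this has_integral_mult_right[OF Suc.IH, of "2 * real k + 1"]]
  have "((\<lambda>t. (2 * real k + 2) * sin t ^ (2 * Suc k)) has_integral
      ((2 * real k + 1) * (pi * fact (2 * k) / (4 ^ k * (fact k)\<^sup>2)))) {0..pi}"
    by simp
  moreover have "1 / (2 * real k + 2) * ((2 * real k + 2) * u) = u" for u :: real
    using of_nat_0_le_iff[of k, where ?'a = real] by (simp add: field_simps)
  ultimately
  have "((\<lambda>t. sin t ^ (2 * Suc k)) has_integral
      (1 / (2 * real k + 2) * ((2 * real k + 1) * (pi * fact (2 * k) / (4 ^ k * (fact k)\<^sup>2))))) {0..pi}"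
    using has_integral_mult_right[of "\<lambda>t. (2 * real k + 2) * sin t ^ (2 * Suc k)" _ _ "1 / (2 * real k + 2)"]
    by presburger
  also have "1 / (2 * real k + 2) * ((2 * real k + 1) * (pi * fact (2 * k) / (4 ^ k * (fact k)\<^sup>2)))
      = pi * fact (2 * Suc k) / (4 ^ Suc k * (fact (Suc k))\<^sup>2)"
    by (simp add: divide_simps power2_eq_square) (simp add: algebra_simps)
  finally show ?case .
qed

text \<open>Both summands are odd in \<open>w\<close>. In degree 2m+1 their coefficients are, up to
  the common sign, 1/(2m+1)! and 1/(2m)! = (2m+1)/(2m+1)!, which add up to (2m+2)/(2m+1)!.\<close>

lemma sin_add_mult_cos_sums:
  fixes w :: complex
  shows "(\<lambda>m. (-1) ^ m * of_nat (2 * m + 2) / fact (2 * m + 1) * w ^ (2 * m + 1))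
    sums (sin w + w * cos w)"
proof -
  \<comment> \<open>Grouping the terms in pairs 2m, 2m+1 absorbs the vanishing even coefficients and
    reindexes the series by m.\<close>
  have "(\<lambda>m. \<Sum>k = m*2..<m * 2 + 2. sin_coeff k *\<^sub>R w ^ k) sums sin w"
    by (rule sums_group) (use sin_converges[of w] in auto)
  then have s: "(\<lambda>m. (-1) ^ m / fact (2 * m + 1) * w ^ (2 * m + 1)) sums sin w"
    by (simp add: sin_coeff_def scaleR_conv_of_real ac_simps)
  have "(\<lambda>m. \<Sum>k = m*2..<m * 2 + 2. cos_coeff k *\<^sub>R w ^ k) sums cos w"
    by (rule sums_group) (use cos_converges[of w] in auto)
  then have c: "(\<lambda>m. (-1) ^ m / fact (2 * m) * w ^ (2 * m)) sums cos w"
    by (simp add: cos_coeff_def scaleR_conv_of_real ac_simps)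
  have nz: "(1 + 2 * of_nat m :: complex) \<noteq> 0" for m
    using of_nat_neq_0[of "2 * m", where ?'a = complex] by simp
  have "(-1) ^ m / fact (2 * m + 1) * w ^ (2 * m + 1) + w * ((-1) ^ m / fact (2 * m) * w ^ (2 * m))
    = (-1) ^ m * of_nat (2 * m + 2) / fact (2 * m + 1) * w ^ (2 * m + 1)" for m
    using nz[of m] by (simp add: divide_simps) (simp add: algebra_simps)
  then show ?thesis
    using sums_add[OF s sums_mult[OF c, of w]] by simp
qed

text \<open>Absolute convergence of the preceding series, inherited from sine and cosine. With
  \<open>r\<close> = \<open>norm x\<close> it supplies the majorant for the Weierstrass
  test.\<close>

lemma summable_sin_add_mult_cos_coeffs:
  fixes r :: real
  shows "summable (\<lambda>m. real (2 * m + 2) / fact (2 * m + 1) * r ^ (2 * m + 1))"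
proof -
  have s: "summable (\<lambda>m. \<Sum>k = m*2..<m * 2 + 2. norm (sin_coeff k *\<^sub>R r ^ k))"
    using sums_group[OF summable_sums[OF summable_norm_sin[of r]], of 2] by (auto simp: sums_iff)
  have c: "summable (\<lambda>m. \<Sum>k = m*2..<m * 2 + 2. norm (cos_coeff k *\<^sub>R r ^ k))"
    using sums_group[OF summable_sums[OF summable_norm_cos[of r]], of 2] by (auto simp: sums_iff)
  have "summable (\<lambda>m. \<bar>r\<bar> ^ (2 * m + 1) / fact (2 * m + 1) + \<bar>r\<bar> * (\<bar>r\<bar> ^ (2 * m) / fact (2 * m)))"
    using summable_add[OF s summable_mult[OF c, of "\<bar>r\<bar>"]]
    by (simp add: sin_coeff_def cos_coeff_def abs_mult power_abs ac_simps)
  also have "(\<lambda>m. \<bar>r\<bar> ^ (2 * m + 1) / fact (2 * m + 1) + \<bar>r\<bar> * (\<bar>r\<bar> ^ (2 * m) / fact (2 * m)))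
    = (\<lambda>m. norm (real (2 * m + 2) / fact (2 * m + 1) * r ^ (2 * m + 1)))"
    by (rule ext) (simp add: abs_mult power_abs divide_simps, simp add: algebra_simps)
  finally show ?thesis by (rule summable_norm_cancel)
qed

theorem mainTheorem3:
  fixes x :: complex
  assumes "x \<noteq> 0"
  shows "bessel_J0 x =
    1 / (complex_of_real pi * x) *
      integral {0..pi} (\<lambda>\<phi>::real.
        sin (complex_of_real \<phi>) * deriv (\<lambda>z. z * sin (z * sin (complex_of_real \<phi>))) x)"
proof -
  \<comment> \<open>\<open>a m\<close> is the coefficient of the power 2m+2 of sin \<phi> in the
    integrand: degree 2m+1 from the series at x sin \<phi>, one more from the outer sine.
    \<open>b m\<close> is the integral of that term, by the Wallis formula at m+1.\<close>
  define a :: "nat \<Rightarrow> complex" where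
    "a m = (-1) ^ m * of_nat (2 * m + 2) / fact (2 * m + 1) * x ^ (2 * m + 1)" for m
  define b where "b m = a m * of_real (pi * fact (2 * Suc m) / (4 ^ Suc m * (fact (Suc m))\<^sup>2))" for m
  let ?s = "\<lambda>\<phi>::real. sin (complex_of_real \<phi>)"
  let ?g = "\<lambda>\<phi>. ?s \<phi> * deriv (\<lambda>z. z * sin (z * ?s \<phi>)) x"
  let ?f = "\<lambda>m \<phi>. a m * ?s \<phi> ^ (2 * Suc m)"
  have g: "(\<Sum>m. ?f m \<phi>) = ?g \<phi>" for \<phi>
  proof -
    have "(\<lambda>m. ?s \<phi> * ((-1) ^ m * of_nat (2 * m + 2) / fact (2 * m + 1) * (x * ?s \<phi>) ^ (2 * m + 1)))
        sums ?g \<phi>"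
      unfolding deriv_mult_sin_mult by (intro sums_mult sin_add_mult_cos_sums)
    moreover have "?s \<phi> * ((-1) ^ m * of_nat (2 * m + 2) / fact (2 * m + 1) * (x * ?s \<phi>) ^ (2 * m + 1))
        = ?f m \<phi>" for m
      by (simp add: a_def power_mult_distrib algebra_simps)
    ultimately show ?thesis by (simp add: sums_iff)
  qed
  have "uniform_limit {0..pi} (\<lambda>n \<phi>. \<Sum>m<n. ?f m \<phi>) (\<lambda>\<phi>. \<Sum>m. ?f m \<phi>) sequentially"
  proof (rule Weierstrass_m_test)
    show "summable (\<lambda>m. norm (a m))"
      using summable_sin_add_mult_cos_coeffs[of "norm x"]
      by (simp only: a_def norm_mult norm_divide norm_power norm_fact norm_minus_cancel norm_one
          power_one norm_of_nat mult_1)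
    show "norm (?f m \<phi>) \<le> norm (a m)" for m \<phi>
    proof -
      \<comment> \<open>This relies on \<phi> being real; the complex sine is unbounded.\<close>
      have "norm (?s \<phi>) \<le> 1"
        by (simp add: sin_of_real)
      then have "norm (?s \<phi>) ^ (2 * Suc m) \<le> 1"
        by (intro power_le_one) auto
      then show ?thesis
        unfolding norm_mult norm_power by (intro mult_left_le) auto
    qed
  qed
  then obtain I J where I: "\<And>n. ((\<lambda>\<phi>. \<Sum>m<n. ?f m \<phi>) has_integral I n) {0..pi}"
    and J: "((\<lambda>\<phi>. \<Sum>m. ?f m \<phi>) has_integral J) {0..pi}" and IJ: "I \<longlonglongrightarrow> J"
    by (rule uniform_limit_integral) (auto intro!: continuous_intros)
  have "(?f m has_integral b m) {0..pi}" for m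
    using has_integral_mult_right[OF has_integral_of_real[OF has_integral_sin_even_power[of "Suc m"]], of "a m"]
    unfolding b_def by (simp only: of_real_power sin_of_real)
  then have "((\<lambda>\<phi>. \<Sum>m<n. ?f m \<phi>) has_integral (\<Sum>m<n. b m)) {0..pi}" for n
    by (intro has_integral_sum) auto
  then have "I = (\<lambda>n. \<Sum>m<n. b m)"
    using I has_integral_unique by blast
  with IJ have "b sums J" by (simp add: sums_def)
  \<comment> \<open>The factorials (2m+1)! cancel and leave (2m+2)^2 = 4 (m+1)^2 over 4^(m+1)
    ((m+1)!)^2, that is 1 / (4^m (m!)^2). The remaining 4^m turns x^(2m+1) into x
    (x/2)^(2m).\<close>
  moreover have "b = (\<lambda>m. of_real pi * x * ((-1) ^ m / (fact m)\<^sup>2 * (x / 2) ^ (2 * m)))"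
  proof
    fix m
    have "(1 + of_nat m :: complex) \<noteq> 0"
      using of_nat_neq_0[of m, where ?'a = complex] by simp
    moreover have "fact (2 * Suc m) = of_nat (2 * m + 2) * (fact (2 * m + 1) :: complex)"
      by (simp add: algebra_simps)
    moreover have "(4 :: complex) ^ m = 2 ^ (m * 2)"
      by (simp add: power_mult mult.commute[of m])
    moreover have "x ^ (2 * m + 1) = 4 ^ m * (x / 2) ^ (2 * m) * x"
      by (simp add: power_divide power_mult)
    moreover have "(fact (Suc m) :: complex) = (1 + of_nat m) * fact m" by simp
    ultimately show "b m = of_real pi * x * ((-1) ^ m / (fact m)\<^sup>2 * (x / 2) ^ (2 * m))"
      unfolding a_def b_def of_real_mult of_real_divide of_real_power of_real_fact
      by (simp add: divide_simps power2_eq_square del: fact_Suc) (simp add: algebra_simps)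
  qed
  ultimately have "(\<lambda>m. of_real pi * x * ((-1) ^ m / (fact m)\<^sup>2 * (x / 2) ^ (2 * m))) sums J"
    by (simp only:)
  then have "J = of_real pi * x * bessel_J0 x"
    using sums_mult[OF summable_sums[OF summable_bessel_J0[of x]], of "of_real pi * x"]
    unfolding bessel_J0_def by (rule sums_unique2)
  moreover have "integral {0..pi} ?g = J"
    using J unfolding g by (rule integral_unique)
  ultimately show ?thesis
    using assms by simp
qed

end
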